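(* There is a closed (in fact $\Pi^0_1$) subset $Q \subseteq \mathbb{N}^{\mathbb{N}}$ of Baire space that is not Medvedev equivalent to any closed subset $P \subseteq 2^{\mathbb{N}}$ of Cantor space.
   Context: Baire space $\mathbb{N}^{\mathbb{N}}$ is the set of all functions $\mathbb{N}\to\mathbb{N}$, and Cantor space $2^{\mathbb{N}}$ the set of all functions $\mathbb{N}\to\{0,1\}$, each with the topology generated by the sets $[\sigma] = \{f : \sigma \subseteq f\}$ for finite sequences $\sigma$. A $\Pi^0_1$ subset of Baire space is the set of infinite paths through a computable tree $T\subseteq\mathbb{N}^{<\mathbb{N}}$. For mass problems $P, Q \subseteq \mathbb{N}^{\mathbb{N}}$, $P \leq_s Q$ (Medvedev reducibility) means there is a Turing functional $\Phi$ such that $\Phi(g) \in P$ for every $g \in Q$; $P$ and $Q$ are Medvedev equivalent if $P \leq_s Q$ and $Q \leq_s P$. *)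

theory Defs
  imports "HOL-Analysis.Abstract_Topology" "HOL-Library.Nat_Bijection" "HOL-Library.Sublist"
begin

text \<open>Kleene's schemes for the partial functions that are recursive in an oracle
  \<^term>\<open>g :: nat \<Rightarrow> nat\<close>; \<open>None\<close> means that the computation diverges (or that the arity is wrong).\<close>

datatype recf =
    Zero
  | Succ
  | Proj nat
  | Oracle
  | Comp recf "recf list"
  | PrimRec recf recf
  | Mu recf

primrec eval :: "recf \<Rightarrow> (nat \<Rightarrow> nat) \<Rightarrow> nat list \<Rightarrow> nat option" where
  "eval Zero = (\<lambda>g xs. Some 0)"
| "eval Succ = (\<lambda>g xs. case xs of [x] \<Rightarrow> Some (Suc x) | _ \<Rightarrow> None)"
| "eval (Proj i) = (\<lambda>g xs. if i < length xs then Some (xs ! i) else None)"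
| "eval Oracle = (\<lambda>g xs. case xs of [x] \<Rightarrow> Some (g x) | _ \<Rightarrow> None)"
| "eval (Comp f hs) =
     (\<lambda>g xs. Option.bind (those (map (\<lambda>h. eval h g xs) hs)) (eval f g))"
| "eval (PrimRec f h) =
     (\<lambda>g xs. case xs of
        [] \<Rightarrow> None
      | n # ys \<Rightarrow>
          rec_nat (eval f g ys) (\<lambda>m r. Option.bind r (\<lambda>y. eval h g (m # y # ys))) n)"
| "eval (Mu f) =
     (\<lambda>g xs. if \<exists>n. eval f g (n # xs) = Some 0 \<and> (\<forall>m<n. \<exists>k. eval f g (m # xs) = Some (Suc k))
             then Some (LEAST n. eval f g (n # xs) = Some 0)
             else None)"

fun oracle_free :: "recf \<Rightarrow> bool" where
  "oracle_free Zero = True"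
| "oracle_free Succ = True"
| "oracle_free (Proj i) = True"
| "oracle_free Oracle = False"
| "oracle_free (Comp f hs) = (oracle_free f \<and> (\<forall>h\<in>set hs. oracle_free h))"
| "oracle_free (PrimRec f h) = (oracle_free f \<and> oracle_free h)"
| "oracle_free (Mu f) = oracle_free f"

lemma oracle_free_eval: "oracle_free c \<Longrightarrow> eval c g = eval c g'"
proof (induction c)
  case (Comp f hs)
  then have "map (\<lambda>h. eval h g xs) hs = map (\<lambda>h. eval h g' xs) hs" for xs
    by (intro map_cong refl) (metis oracle_free.simps(5))
  moreover have "eval f g = eval f g'"
    using Comp by simp
  ultimately show ?case
    by (simp only: eval.simps)
next
  case (Mu f)
  then have "eval f g = eval f g'"
    by simp
  then show ?case
    by (simp only: eval.simps)
qed simp_all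

text \<open>By the lemma above, the oracle supplied here is irrelevant.\<close>

definition computable :: "(nat \<Rightarrow> nat) \<Rightarrow> bool" where
  "computable f \<longleftrightarrow> (\<exists>c. oracle_free c \<and> (\<forall>n. eval c (\<lambda>_. 0) [n] = Some (f n)))"

definition turing_functional :: "((nat \<Rightarrow> nat) \<Rightarrow> nat \<Rightarrow> nat option) \<Rightarrow> bool" where
  "turing_functional \<Phi> \<longleftrightarrow> (\<exists>c. \<forall>g n. \<Phi> g n = eval c g [n])"

text \<open>\<open>\<Phi>(g) \<in> P\<close> means that \<open>\<Phi> g\<close> is total and, as a total function, belongs to \<open>P\<close>.\<close>

definition medvedev_le :: "(nat \<Rightarrow> nat) set \<Rightarrow> (nat \<Rightarrow> nat) set \<Rightarrow> bool" (infix "\<le>\<^sub>s" 50) where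
  "P \<le>\<^sub>s Q \<longleftrightarrow> (\<exists>\<Phi>. turing_functional \<Phi> \<and> (\<forall>g\<in>Q. \<exists>f\<in>P. \<Phi> g = Some \<circ> f))"

definition medvedev_equiv :: "(nat \<Rightarrow> nat) set \<Rightarrow> (nat \<Rightarrow> nat) set \<Rightarrow> bool" where
  "medvedev_equiv P Q \<longleftrightarrow> P \<le>\<^sub>s Q \<and> Q \<le>\<^sub>s P"

definition cylinder :: "nat set \<Rightarrow> nat list \<Rightarrow> (nat \<Rightarrow> nat) set" where
  "cylinder A \<sigma> = {f. range f \<subseteq> A \<and> map f [0..<length \<sigma>] = \<sigma>}"

definition sequence_space :: "nat set \<Rightarrow> (nat \<Rightarrow> nat) topology" where
  "sequence_space A = topology_generated_by {cylinder A \<sigma> |\<sigma>. set \<sigma> \<subseteq> A}"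

abbreviation baire_space :: "(nat \<Rightarrow> nat) topology" where
  "baire_space \<equiv> sequence_space UNIV"

abbreviation cantor_space :: "(nat \<Rightarrow> nat) topology" where
  "cantor_space \<equiv> sequence_space {0, 1}"

lemma topspace_sequence_space: "topspace (sequence_space A) = {f. range f \<subseteq> A}"
proof -
  have "\<Union> {cylinder A \<sigma> |\<sigma>. set \<sigma> \<subseteq> A} = cylinder A []"
  proof (rule antisym)
    show "\<Union> {cylinder A \<sigma> |\<sigma>. set \<sigma> \<subseteq> A} \<subseteq> cylinder A []"
      unfolding cylinder_def by auto
    have "cylinder A [] \<in> {cylinder A \<sigma> |\<sigma>. set \<sigma> \<subseteq> A}"
      by (intro CollectI exI[of _ "[]"]) simp
    then show "cylinder A [] \<subseteq> \<Union> {cylinder A \<sigma> |\<sigma>. set \<sigma> \<subseteq> A}"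
      by (rule Union_upper)
  qed
  then show ?thesis
    by (simp only: sequence_space_def topology_generated_by_topspace) (simp add: cylinder_def)
qed

definition tree :: "nat list set \<Rightarrow> bool" where
  "tree T \<longleftrightarrow> (\<forall>\<sigma>\<in>T. \<forall>\<tau>. prefix \<tau> \<sigma> \<longrightarrow> \<tau> \<in> T)"

definition paths :: "nat list set \<Rightarrow> (nat \<Rightarrow> nat) set" where
  "paths T = {f. \<forall>n. map f [0..<n] \<in> T}"

definition computable_tree :: "nat list set \<Rightarrow> bool" where
  "computable_tree T \<longleftrightarrow> tree T \<and> computable (\<lambda>n. of_bool (n \<in> list_encode ` T))"

definition Pi01_class :: "(nat \<Rightarrow> nat) set \<Rightarrow> bool" where
  "Pi01_class Q \<longleftrightarrow> (\<exists>T. computable_tree T \<and> Q = paths T)"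

end

theory Submission imports Defs begin

text \<open>
  If \<open>Q\<close> is Medvedev equivalent to a closed \<open>P \<subseteq> 2\<^sup>\<nat>\<close>, then composing the two reductions gives a
  Turing functional \<open>\<Theta>\<close> from \<open>Q\<close> to \<open>Q\<close> that factors through the compact set \<open>P\<close>; hence for each
  \<open>n\<close> the value \<open>\<Theta>(g)(n)\<close> takes only finitely many values as \<open>g\<close> ranges over \<open>Q\<close>. The class
  \<open>Q = {f. \<forall>n. f(n) \<noteq> \<psi>(n)}\<close> admits no such \<open>\<Theta>\<close> for the following partial computable \<open>\<psi>\<close>: let
  \<open>\<psi>(n)\<close> be the first colour \<open>i\<close> for which a finite tree is found, with at least two children at
  every inner node, such that the \<open>n\<close>-th functional has value \<open>i\<close> at \<open>n\<close> on every leaf. Let \<open>n\<close> be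
  an index of \<open>\<Theta>\<close>. A node has infinitely many children that avoid \<open>\<psi>\<close>, but there are only finitely
  many colours, so by the pigeonhole principle a node without such a tree above it has a child
  without one that avoids \<open>\<psi>\<close>; if the root had no such tree, this would yield a member of \<open>Q\<close> on
  which \<open>\<Theta>\<close> has no value at \<open>n\<close>. So \<open>\<psi>(n)\<close> is defined. As \<open>\<psi>\<close> rules out at most one child of each
  node, the tree found has a leaf that avoids \<open>\<psi>\<close>, and this leaf extends to some \<open>g \<in> Q\<close> with
  \<open>\<Theta>(g)(n) = \<psi>(n)\<close>, contradicting \<open>\<Theta>(g) \<in> Q\<close>.
\<close>

section \<open>Closure properties of the recursive functions\<close>

text \<open>Arguments are read off as \<open>xs ! i\<close>, so the closure lemmas below serve as
  introduction rules on the function itself and concrete programs rarely have to be written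
  out.\<close>

definition recfun :: "nat \<Rightarrow> (nat list \<Rightarrow> nat) \<Rightarrow> bool" where
  "recfun k F \<longleftrightarrow>
     (\<exists>c. oracle_free c \<and> (\<forall>g xs. length xs = k \<longrightarrow> eval c g xs = Some (F xs)))"

definition recpred :: "nat \<Rightarrow> (nat list \<Rightarrow> bool) \<Rightarrow> bool" where
  "recpred k P \<longleftrightarrow> recfun k (\<lambda>xs. of_bool (P xs))"

lemma recfun_cong:
  assumes "recfun k F" "\<And>xs. length xs = k \<Longrightarrow> F xs = G xs"
  shows "recfun k G"
  using assms unfolding recfun_def by metis

lemma recpred_cong:
  assumes "recpred k P" "\<And>xs. length xs = k \<Longrightarrow> P xs = R xs"
  shows "recpred k R"
  using assms(1) unfolding recpred_def by (rule recfun_cong) (simp add: assms(2))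

lemma those_map_Some: "those (map (\<lambda>x. Some (f x)) xs) = Some (map f xs)"
  by (induction xs) auto

lemma recfun_comp:
  assumes F: "recfun (length Hs) F" and H: "\<And>H. H \<in> set Hs \<Longrightarrow> recfun k H"
  shows "recfun k (\<lambda>xs. F (map (\<lambda>H. H xs) Hs))"
proof -
  obtain c where c: "oracle_free c" "\<And>g xs. length xs = length Hs \<Longrightarrow> eval c g xs = Some (F xs)"
    using F unfolding recfun_def by metis
  have "\<forall>H\<in>set Hs. \<exists>d. oracle_free d \<and> (\<forall>g xs. length xs = k \<longrightarrow> eval d g xs = Some (H xs))"
    using H unfolding recfun_def by blast
  then obtain d where d: "\<And>H. H \<in> set Hs \<Longrightarrow> oracle_free (d H)"
    "\<And>H g xs. H \<in> set Hs \<Longrightarrow> length xs = k \<Longrightarrow> eval (d H) g xs = Some (H xs)"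
    by metis
  have "eval (Comp c (map d Hs)) g xs = Some (F (map (\<lambda>H. H xs) Hs))" if "length xs = k" for g xs
  proof -
    have "map (\<lambda>h. eval h g xs) (map d Hs) = map (\<lambda>H. Some (H xs)) Hs"
      using d that by simp
    then show ?thesis
      by (simp only: eval.simps) (simp add: those_map_Some c)
  qed
  moreover have "oracle_free (Comp c (map d Hs))"
    using c d by simp
  ultimately show ?thesis
    unfolding recfun_def by blast
qed

lemma recfun_comp1:
  assumes "recfun 1 (\<lambda>xs. f (xs ! 0))" "recfun k A"
  shows "recfun k (\<lambda>xs. f (A xs))"
  using recfun_comp[of "[A]" "\<lambda>xs. f (xs ! 0)" k] assms by simp

lemma recfun_comp2:
  assumes "recfun 2 (\<lambda>xs. f (xs ! 0) (xs ! 1))" "recfun k A" "recfun k B"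
  shows "recfun k (\<lambda>xs. f (A xs) (B xs))"
  using recfun_comp[of "[A, B]" "\<lambda>xs. f (xs ! 0) (xs ! 1)" k] assms
  by (auto simp: numeral_2_eq_2)

lemma recfun_comp5:
  assumes "recfun 5 (\<lambda>xs. f (xs ! 0) (xs ! 1) (xs ! 2) (xs ! 3) (xs ! 4))"
    "recfun k A" "recfun k B" "recfun k C" "recfun k D" "recfun k E"
  shows "recfun k (\<lambda>xs. f (A xs) (B xs) (C xs) (D xs) (E xs))"
proof -
  let ?F = "\<lambda>xs. f (xs ! 0) (xs ! 1) (xs ! 2) (xs ! 3) (xs ! 4)"
  have "recfun k (\<lambda>xs. ?F (map (\<lambda>H. H xs) [A, B, C, D, E]))"
    by (rule recfun_comp) (use assms in \<open>auto simp: numeral_eq_Suc\<close>)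
  then show ?thesis by simp
qed

lemma recpred_comp1:
  assumes "recpred 1 (\<lambda>xs. P (xs ! 0))" "recfun k A"
  shows "recpred k (\<lambda>xs. P (A xs))"
  using assms unfolding recpred_def by (rule recfun_comp1[where f = "\<lambda>x. of_bool (P x)"])

lemma recpred_comp2:
  assumes "recpred 2 (\<lambda>xs. P (xs ! 0) (xs ! 1))" "recfun k A" "recfun k B"
  shows "recpred k (\<lambda>xs. P (A xs) (B xs))"
  using assms unfolding recpred_def by (rule recfun_comp2[where f = "\<lambda>x y. of_bool (P x y)"])

lemma recpred_comp5:
  assumes "recpred 5 (\<lambda>xs. P (xs ! 0) (xs ! 1) (xs ! 2) (xs ! 3) (xs ! 4))"
    "recfun k A" "recfun k B" "recfun k C" "recfun k D" "recfun k E"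
  shows "recpred k (\<lambda>xs. P (A xs) (B xs) (C xs) (D xs) (E xs))"
  using assms unfolding recpred_def
  by (rule recfun_comp5[where f = "\<lambda>u v x y z. of_bool (P u v x y z)"])

lemma recfun_nth: "i < k \<Longrightarrow> recfun k (\<lambda>xs. xs ! i)"
  unfolding recfun_def by (intro exI[of _ "Proj i"]) simp

text \<open>Needed under binders: a quantifier, minimisation or recursion puts its variable at the
  head of the argument list, and the old arguments become the tail.\<close>

lemma recfun_tl:
  assumes "recfun k F"
  shows "recfun (Suc k) (\<lambda>xs. F (tl xs))"
proof -
  let ?Hs = "map (\<lambda>i xs. xs ! Suc i) [0..<k]"
  have "recfun (Suc k) (\<lambda>xs. F (map (\<lambda>H. H xs) ?Hs))"
    by (rule recfun_comp) (auto simp: assms intro: recfun_nth)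
  then show ?thesis
  proof (rule recfun_cong)
    fix xs :: "nat list" assume "length xs = Suc k"
    then have "map (\<lambda>H. H xs) ?Hs = tl xs"
      by (intro nth_equalityI) (auto simp: nth_tl)
    then show "F (map (\<lambda>H. H xs) ?Hs) = F (tl xs)" by simp
  qed
qed

lemma recfun_tl_nth: "Suc i < k \<Longrightarrow> recfun k (\<lambda>xs. tl xs ! i)"
  using recfun_tl[OF recfun_nth, of i "k - 1"] by simp

lemma recfun_tl_tl_nth: "Suc (Suc i) < k \<Longrightarrow> recfun k (\<lambda>xs. tl (tl xs) ! i)"
  using recfun_tl[OF recfun_tl_nth, of i "k - 1"] by simp

lemma recfun_Suc: "recfun k A \<Longrightarrow> recfun k (\<lambda>xs. Suc (A xs))"
proof (rule recfun_comp1[where f = Suc])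
  show "recfun 1 (\<lambda>xs. Suc (xs ! 0))"
    unfolding recfun_def by (intro exI[of _ Succ]) (auto simp: length_Suc_conv)
qed

lemma recfun_const: "recfun k (\<lambda>_. n)"
proof (induction n)
  case 0
  show ?case
    unfolding recfun_def by (intro exI[of _ Zero]) simp
qed (rule recfun_Suc)

lemma recfun_rec:
  assumes F: "recfun k F" and H: "recfun (Suc (Suc k)) (\<lambda>xs. H (xs ! 0) (xs ! 1) (tl (tl xs)))"
    and N: "recfun k N"
  shows "recfun k (\<lambda>xs. rec_nat (F xs) (\<lambda>m r. H m r xs) (N xs))"
proof -
  obtain c where c: "oracle_free c" "\<And>g xs. length xs = k \<Longrightarrow> eval c g xs = Some (F xs)"
    using F unfolding recfun_def by metis
  obtain d where d: "oracle_free d"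
    "\<And>g xs. length xs = Suc (Suc k) \<Longrightarrow> eval d g xs = Some (H (xs ! 0) (xs ! 1) (tl (tl xs)))"
    using H unfolding recfun_def by metis
  have "rec_nat (eval c g xs) (\<lambda>m r. Option.bind r (\<lambda>y. eval d g (m # y # xs))) n
      = Some (rec_nat (F xs) (\<lambda>m r. H m r xs) n)" if "length xs = k" for g xs n
    by (induction n) (simp_all add: c d that)
  then have "eval (PrimRec c d) g (n # xs) = Some (rec_nat (F xs) (\<lambda>m r. H m r xs) n)"
    if "length xs = k" for g xs n
    using that by simp
  moreover have "oracle_free (PrimRec c d)"
    using c d by simp
  ultimately have *: "recfun (Suc k) (\<lambda>ys. rec_nat (F (tl ys)) (\<lambda>m r. H m r (tl ys)) (hd ys))"
    unfolding recfun_def by (intro exI[of _ "PrimRec c d"]) (auto simp: length_Suc_conv)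
  \<comment> \<open>\<open>PrimRec\<close> recurses on its first argument, so \<open>N\<close> is
    fed in there, followed by the unchanged arguments.\<close>
  let ?Hs = "N # map (\<lambda>i xs. xs ! i) [0..<k]"
  have "recfun k (\<lambda>xs. (\<lambda>ys. rec_nat (F (tl ys)) (\<lambda>m r. H m r (tl ys)) (hd ys))
      (map (\<lambda>G. G xs) ?Hs))"
    by (rule recfun_comp) (use N * in \<open>auto intro: recfun_nth\<close>)
  then show ?thesis
  proof (rule recfun_cong)
    fix xs :: "nat list" assume "length xs = k"
    then have "map (\<lambda>G. G xs) ?Hs = N xs # xs"
      by (auto intro: nth_equalityI)
    then show "(\<lambda>ys. rec_nat (F (tl ys)) (\<lambda>m r. H m r (tl ys)) (hd ys)) (map (\<lambda>G. G xs) ?Hs)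
      = rec_nat (F xs) (\<lambda>m r. H m r xs) (N xs)" by simp
  qed
qed

lemma recfun_add: "recfun k A \<Longrightarrow> recfun k B \<Longrightarrow> recfun k (\<lambda>xs. A xs + B xs)"
proof (rule recfun_comp2[where f = "(+)"])
  have "recfun 2 (\<lambda>xs. rec_nat (xs ! 0) (\<lambda>m r. Suc r) (xs ! 1))"
    by (intro recfun_rec[where H = "\<lambda>m r xs. Suc r"] recfun_nth recfun_Suc) auto
  moreover have "rec_nat a (\<lambda>m r. Suc r) b = a + b" for a b
    by (induction b) auto
  ultimately show "recfun 2 (\<lambda>xs. xs ! 0 + xs ! 1)" by simp
qed

lemma recfun_diff: "recfun k A \<Longrightarrow> recfun k B \<Longrightarrow> recfun k (\<lambda>xs. A xs - B xs)"
proof (rule recfun_comp2[where f = "(-)"])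
  have "recfun 1 (\<lambda>xs. rec_nat 0 (\<lambda>m r. m) (xs ! 0))"
    by (intro recfun_rec[where H = "\<lambda>m r xs. m"] recfun_nth recfun_const) auto
  moreover have "rec_nat 0 (\<lambda>m r. m) b = b - 1" for b :: nat
    by (cases b) auto
  ultimately have pred: "recfun k A \<Longrightarrow> recfun k (\<lambda>xs. A xs - 1)" for k A
    using recfun_comp1[of "\<lambda>x. x - 1"] by simp
  have "recfun 2 (\<lambda>xs. rec_nat (xs ! 0) (\<lambda>m r. r - 1) (xs ! 1))"
    by (intro recfun_rec[where H = "\<lambda>m r xs. r - 1"] recfun_nth pred) auto
  moreover have "rec_nat a (\<lambda>m r. r - 1) b = a - b" for a b :: nat
    by (induction b) auto
  ultimately show "recfun 2 (\<lambda>xs. xs ! 0 - xs ! 1)" by simp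
qed

lemma recfun_triangle: "recfun k A \<Longrightarrow> recfun k (\<lambda>xs. triangle (A xs))"
proof (rule recfun_comp1[where f = triangle])
  have "recfun 1 (\<lambda>xs. rec_nat 0 (\<lambda>m r. r + Suc m) (xs ! 0))"
    by (intro recfun_rec[where H = "\<lambda>m r xs. r + Suc m"] recfun_nth recfun_const recfun_add
        recfun_Suc) auto
  moreover have "rec_nat 0 (\<lambda>m r. r + Suc m) n = triangle n" for n
    by (induction n) auto
  ultimately show "recfun 1 (\<lambda>xs. triangle (xs ! 0))" by simp
qed

lemma recfun_prod_encode:
  "recfun k A \<Longrightarrow> recfun k B \<Longrightarrow> recfun k (\<lambda>xs. prod_encode (A xs, B xs))"
  unfolding prod_encode_def by (simp add: recfun_add recfun_triangle)

lemma recpred_less: "recfun k A \<Longrightarrow> recfun k B \<Longrightarrow> recpred k (\<lambda>xs. A xs < B xs)"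
proof -
  \<comment> \<open>This recursion is the sign function; \<open>A < B\<close> becomes positivity of
    the truncated difference \<open>B - A\<close>.\<close>
  have "recfun 1 (\<lambda>xs. rec_nat 0 (\<lambda>m r. 1) (xs ! 0))"
    by (intro recfun_rec[where H = "\<lambda>m r xs. 1"] recfun_nth recfun_const) auto
  moreover have "rec_nat 0 (\<lambda>m r. 1) b = (of_bool (0 < b) :: nat)" for b :: nat
    by (cases b) auto
  ultimately have "recfun 1 (\<lambda>xs. of_bool (0 < xs ! 0))" by simp
  then have "recpred k (\<lambda>xs. 0 < A xs)" if "recfun k A" for k A
    using recpred_comp1[of "\<lambda>x. 0 < x"] that unfolding recpred_def by blast
  moreover assume "recfun k A" "recfun k B"
  ultimately have "recpred k (\<lambda>xs. 0 < B xs - A xs)"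
    using recfun_diff by blast
  then show ?thesis by simp
qed

lemma recpred_not: "recpred k P \<Longrightarrow> recpred k (\<lambda>xs. \<not> P xs)"
proof -
  assume "recpred k P"
  then have "recpred k (\<lambda>xs. of_bool (P xs) < (1::nat))"
    using recpred_less recfun_const unfolding recpred_def[of k P] by blast
  then show ?thesis by simp
qed

lemma recpred_or: "recpred k P \<Longrightarrow> recpred k R \<Longrightarrow> recpred k (\<lambda>xs. P xs \<or> R xs)"
proof -
  assume "recpred k P" "recpred k R"
  then have "recpred k (\<lambda>xs. 0 < of_bool (P xs) + (of_bool (R xs) :: nat))"
    using recpred_less recfun_const recfun_add unfolding recpred_def[of k P] recpred_def[of k R]
    by blast
  then show ?thesis by simp
qed

lemma recpred_and: "recpred k P \<Longrightarrow> recpred k R \<Longrightarrow> recpred k (\<lambda>xs. P xs \<and> R xs)"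
  using recpred_not[OF recpred_or[OF recpred_not recpred_not], of k P R] by simp

lemma recpred_imp: "recpred k P \<Longrightarrow> recpred k R \<Longrightarrow> recpred k (\<lambda>xs. P xs \<longrightarrow> R xs)"
  using recpred_or[OF recpred_not, of k P R] by simp

lemma recpred_eq:
  fixes A B :: "nat list \<Rightarrow> nat"
  shows "recfun k A \<Longrightarrow> recfun k B \<Longrightarrow> recpred k (\<lambda>xs. A xs = B xs)"
  using recpred_and[OF recpred_not[OF recpred_less] recpred_not[OF recpred_less], of k A B B A]
  by (simp add: eq_iff not_less conj_commute)

text \<open>\<open>Mu\<close> searches for a zero, so it is applied to the characteristic function
  of the negation of \<open>P\<close>; \<open>ex\<close> makes the search terminate.\<close>

lemma recfun_Least:
  assumes P: "recpred (Suc k) (\<lambda>ys. P (ys ! 0) (tl ys))"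
    and ex: "\<And>xs. \<exists>n. P n xs"
  shows "recfun k (\<lambda>xs. LEAST n. P n xs)"
proof -
  obtain c where c: "oracle_free c"
    "\<And>g ys. length ys = Suc k \<Longrightarrow> eval c g ys = Some (of_bool (\<not> P (ys ! 0) (tl ys)))"
    using recpred_not[OF P] unfolding recpred_def recfun_def by metis
  have "eval (Mu c) g xs = Some (LEAST n. P n xs)" if "length xs = k" for g xs
  proof -
    have e: "eval c g (n # xs) = Some (of_bool (\<not> P n xs))" for n
      using c(2)[of "n # xs"] that by simp
    define L where "L = (LEAST n. P n xs)"
    have "P L xs" "\<And>m. m < L \<Longrightarrow> \<not> P m xs"
      unfolding L_def using LeastI_ex[OF ex] not_less_Least by metis+
    then have "eval c g (L # xs) = Some 0 \<and>
        (\<forall>m<L. \<exists>j. eval c g (m # xs) = Some (Suc j))"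
      by (simp add: e)
    then have "\<exists>n. eval c g (n # xs) = Some 0 \<and> (\<forall>m<n. \<exists>j. eval c g (m # xs) = Some (Suc j))"
      by (rule exI)
    moreover have "(LEAST n. eval c g (n # xs) = Some 0) = (LEAST n. P n xs)"
      by (simp add: e)
    ultimately show ?thesis by (simp only: eval.simps if_True)
  qed
  then show ?thesis
    unfolding recfun_def using c(1) by (intro exI[of _ "Mu c"]) simp
qed

text \<open>The extra disjunct stops the search at \<open>B xs\<close> at the latest, so the search
  is total and ends strictly below the bound exactly when a witness exists.\<close>

lemma recpred_ex_less:
  assumes B: "recfun k B" and P: "recpred (Suc k) (\<lambda>ys. P (ys ! 0) (tl ys))"
  shows "recpred k (\<lambda>xs. \<exists>i<B xs. P i xs)"
proof -
  let ?L = "\<lambda>xs. LEAST i. P i xs \<or> \<not> i < B xs"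
  have "recfun k ?L"
    by (rule recfun_Least, intro recpred_or P recpred_not recpred_less recfun_nth recfun_tl[OF B])
      auto
  then have "recpred k (\<lambda>xs. ?L xs < B xs)"
    using B recpred_less by blast
  moreover have "?L xs < B xs \<longleftrightarrow> (\<exists>i<B xs. P i xs)" for xs
  proof
    show "\<exists>i<B xs. P i xs" if "?L xs < B xs"
      using that LeastI[of "\<lambda>i. P i xs \<or> \<not> i < B xs" "B xs"] by auto
    show "?L xs < B xs" if "\<exists>i<B xs. P i xs"
      using that by (metis (mono_tags, lifting) Least_le order_le_less_trans)
  qed
  ultimately show ?thesis by simp
qed

lemma recpred_ex:
  assumes "recfun k B" "recpred (Suc k) (\<lambda>ys. P (ys ! 0) (tl ys))"
    and "\<And>i xs. P i xs \<Longrightarrow> i < B xs"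
  shows "recpred k (\<lambda>xs. \<exists>i. P i xs)"
proof (rule recpred_cong)
  show "recpred k (\<lambda>xs. \<exists>i<B xs. P i xs)"
    using assms by (intro recpred_ex_less)
qed (use assms(3) in blast)

lemma recpred_all_less:
  assumes "recfun k B" "recpred (Suc k) (\<lambda>ys. P (ys ! 0) (tl ys))"
  shows "recpred k (\<lambda>xs. \<forall>i<B xs. P i xs)"
  using recpred_not[OF recpred_ex_less[OF assms(1) recpred_not[OF assms(2)]]] by simp

lemma recfun_fst_prod_decode: "recfun k A \<Longrightarrow> recfun k (\<lambda>xs. fst (prod_decode (A xs)))"
proof (rule recfun_comp1[where f = "\<lambda>n. fst (prod_decode n)"])
  \<comment> \<open>Pairing is inverted by search; since components do not exceed their code, the
    second component can be quantified with a bound.\<close>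
  let ?P = "\<lambda>x xs. \<exists>y<Suc (xs ! 0). prod_encode (x, y) = xs ! 0"
  have P: "?P x xs \<longleftrightarrow> x = fst (prod_decode (xs ! 0))" for x xs
  proof
    show "x = fst (prod_decode (xs ! 0))" if "?P x xs"
      using that by (auto dest!: sym[of _ "xs ! 0"])
    show "?P x xs" if "x = fst (prod_decode (xs ! 0))"
      using that le_prod_encode_2[of "snd (prod_decode (xs ! 0))" "fst (prod_decode (xs ! 0))"]
      by (intro exI[of _ "snd (prod_decode (xs ! 0))"]) (simp add: less_Suc_eq_le)
  qed
  have "recfun 1 (\<lambda>xs. LEAST x. ?P x xs)"
    by (rule recfun_Least, intro recpred_ex_less recpred_eq recfun_prod_encode recfun_Suc recfun_nth
        recfun_tl_nth recfun_tl_tl_nth) (auto simp: P)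
  then show "recfun 1 (\<lambda>xs. fst (prod_decode (xs ! 0)))"
    by (simp add: P Least_equality)
qed

lemma recfun_snd_prod_decode: "recfun k A \<Longrightarrow> recfun k (\<lambda>xs. snd (prod_decode (A xs)))"
proof (rule recfun_comp1[where f = "\<lambda>n. snd (prod_decode n)"])
  let ?P = "\<lambda>y xs. prod_encode (fst (prod_decode (xs ! 0)), y) = xs ! 0"
  have P: "?P y xs \<longleftrightarrow> y = snd (prod_decode (xs ! 0))" for y xs
  proof
    assume "?P y xs"
    then have "prod_decode (xs ! 0) = (fst (prod_decode (xs ! 0)), y)"
      by (metis prod_encode_inverse)
    then show "y = snd (prod_decode (xs ! 0))" by (metis snd_conv)
  qed simp
  have "recfun 1 (\<lambda>xs. LEAST y. ?P y xs)"
    by (rule recfun_Least, intro recpred_eq recfun_prod_encode recfun_fst_prod_decode recfun_nth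
        recfun_tl_nth) (auto simp: P)
  then show "recfun 1 (\<lambda>xs. snd (prod_decode (xs ! 0)))"
    by (simp add: P Least_equality)
qed

section \<open>Codes of lists\<close>

text \<open>This keeps \<open>list_encode (x # xs)\<close> as the normal form to which the code
  operations simplify.\<close>

declare list_encode.simps(2) [simp del]

definition cons_code :: "nat \<Rightarrow> nat \<Rightarrow> nat" where
  "cons_code x n = Suc (prod_encode (x, n))"

definition hd_code :: "nat \<Rightarrow> nat" where
  "hd_code n = fst (prod_decode (n - 1))"

definition tl_code :: "nat \<Rightarrow> nat" where
  "tl_code n = snd (prod_decode (n - 1))"

text \<open>Gives access to entries: entry \<open>k\<close> of a coded list is
  \<open>hd_code (drop_code n k)\<close>, and it exists iff \<open>drop_code n k\<close> is
  nonzero.\<close>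

definition drop_code :: "nat \<Rightarrow> nat \<Rightarrow> nat" where
  "drop_code n k = rec_nat n (\<lambda>_. tl_code) k"

lemma cons_code_list_encode [simp]: "cons_code x (list_encode xs) = list_encode (x # xs)"
  by (simp add: cons_code_def list_encode.simps)

lemma cons_code_0 [simp]: "cons_code x 0 = list_encode [x]"
  using cons_code_list_encode[of x "[]"] by simp

lemma hd_code_list_encode [simp]: "hd_code (list_encode (x # xs)) = x"
  by (simp add: hd_code_def list_encode.simps)

lemma tl_code_list_encode [simp]: "tl_code (list_encode xs) = list_encode (tl xs)"
proof (cases xs)
  case Nil
  \<comment> \<open>The empty list has code 0 and \<open>0 - 1 = 0\<close>, so this value makes the
    tail of the empty list empty.\<close>
  have "prod_decode 0 = (0, 0)"
    using prod_encode_inverse[of "(0, 0)"] by (simp add: prod_encode_def)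
  then show ?thesis by (simp add: Nil tl_code_def)
qed (simp add: tl_code_def list_encode.simps)

lemma drop_code_list_encode [simp]: "drop_code (list_encode xs) k = list_encode (drop k xs)"
  by (induction k) (auto simp: drop_code_def drop_Suc tl_drop)

lemma list_encode_eq_0_iff [simp]: "list_encode xs = 0 \<longleftrightarrow> xs = []"
  by (cases xs) (auto simp: list_encode.simps)

lemma hd_code_drop_code [simp]: "k < length xs \<Longrightarrow> hd_code (list_encode (drop k xs)) = xs ! k"
  by (subst Cons_nth_drop_Suc[symmetric]) auto

lemma length_le_list_encode: "length xs \<le> list_encode xs"
proof (induction xs)
  case (Cons x xs)
  then show ?case
    using le_prod_encode_2[of "list_encode xs" x] by (simp add: list_encode.simps)
qed simp

lemma less_list_encode: "x \<in> set xs \<Longrightarrow> x < list_encode xs"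
proof (induction xs)
  case (Cons a xs)
  then show ?case
    using le_prod_encode_2[of "list_encode xs" a] le_prod_encode_1[of a "list_encode xs"]
    by (auto simp: list_encode.simps)
qed simp

lemma recfun_cons_code:
  "recfun k A \<Longrightarrow> recfun k B \<Longrightarrow> recfun k (\<lambda>xs. cons_code (A xs) (B xs))"
  unfolding cons_code_def by (intro recfun_Suc recfun_prod_encode)

lemma recfun_hd_code: "recfun k A \<Longrightarrow> recfun k (\<lambda>xs. hd_code (A xs))"
  unfolding hd_code_def by (intro recfun_fst_prod_decode recfun_diff recfun_const)

lemma recfun_tl_code: "recfun k A \<Longrightarrow> recfun k (\<lambda>xs. tl_code (A xs))"
  unfolding tl_code_def by (intro recfun_snd_prod_decode recfun_diff recfun_const)

lemma recfun_drop_code: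
  "recfun k A \<Longrightarrow> recfun k B \<Longrightarrow> recfun k (\<lambda>xs. drop_code (A xs) (B xs))"
  unfolding drop_code_def
  by (rule recfun_rec[where H = "\<lambda>m r xs. tl_code r"]) (auto intro: recfun_tl_code recfun_nth)

lemmas recursive_intros =
  recfun_const recfun_nth recfun_tl_nth recfun_tl_tl_nth
  recfun_Suc recfun_diff recfun_prod_encode recfun_fst_prod_decode recfun_snd_prod_decode
  recfun_cons_code recfun_hd_code recfun_tl_code recfun_drop_code
  recpred_less recpred_eq recpred_not recpred_and recpred_or recpred_imp
  recpred_ex_less recpred_all_less

lemma recfun_length_list_decode: "recfun k A \<Longrightarrow> recfun k (\<lambda>xs. length (list_decode (A xs)))"
proof (rule recfun_comp1[where f = "\<lambda>n. length (list_decode n)"])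
  have 1: "drop_code n j = 0 \<longleftrightarrow> length (list_decode n) \<le> j" for n j
    using drop_code_list_encode[of "list_decode n" j] by simp
  have "recfun 1 (\<lambda>xs. LEAST j. drop_code (xs ! 0) j = 0)"
    by (rule recfun_Least, intro recursive_intros) (auto simp: 1)
  moreover have "(LEAST j. drop_code n j = 0) = length (list_decode n)" for n
    by (rule Least_equality) (simp_all add: 1)
  ultimately show "recfun 1 (\<lambda>xs. length (list_decode (xs ! 0)))" by simp
qed

lemma recpred_in_list_decode:
  "recfun k A \<Longrightarrow> recfun k B \<Longrightarrow> recpred k (\<lambda>xs. A xs \<in> set (list_decode (B xs)))"
proof (rule recpred_comp2[where P = "\<lambda>x n. x \<in> set (list_decode n)"])
  have "x \<in> set (list_decode n) \<longleftrightarrow> (\<exists>j<n. drop_code n j \<noteq> 0 \<and> hd_code (drop_code n j) = x)" for x n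
  proof -
    obtain xs where n: "n = list_encode xs" by (metis list_decode_inverse)
    have "drop_code n j \<noteq> 0 \<and> hd_code (drop_code n j) = x \<longleftrightarrow> j < length xs \<and> xs ! j = x" for j
      unfolding n by (cases "j < length xs") auto
    then show ?thesis
      using length_le_list_encode[of xs] unfolding n
      by (auto simp: in_set_conv_nth intro: less_le_trans)
  qed
  moreover have "recpred 2 (\<lambda>xs. \<exists>j<xs ! 1. drop_code (xs ! 1) j \<noteq> 0 \<and>
      hd_code (drop_code (xs ! 1) j) = xs ! 0)"
    by (intro recursive_intros) auto
  ultimately show "recpred 2 (\<lambda>xs. xs ! 0 \<in> set (list_decode (xs ! 1)))" by simp
qed

section \<open>Certificates for computations with a finite oracle\<close>

definition fact_code :: "nat \<Rightarrow> nat \<Rightarrow> nat \<Rightarrow> nat \<Rightarrow> nat" where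
  "fact_code \<sigma> c xs y = prod_encode (\<sigma>, prod_encode (c, prod_encode (xs, y)))"

text \<open>Each witness of an unbounded existential in \<open>rule_applies\<close> occurs inside a
  fact in \<open>M\<close>. When \<open>M\<close> is the set of entries of a coded list
  \<open>t\<close>, these bounds turn the search for witnesses into a search below
  \<open>t\<close>.\<close>

lemma fact_code_less:
  assumes "fact_code \<sigma> c xs y \<in> set (list_decode t)"
  shows "\<sigma> < t" "xs < t" "y < t"
proof -
  have "fact_code \<sigma> c xs y < t"
    using less_list_encode[OF assms] by simp
  moreover have "\<sigma> \<le> fact_code \<sigma> c xs y" "xs \<le> fact_code \<sigma> c xs y" "y \<le> fact_code \<sigma> c xs y"
    unfolding fact_code_def by (meson le_prod_encode_1 le_prod_encode_2 order_trans)+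
  ultimately show "\<sigma> < t" "xs < t" "y < t" by auto
qed

lemma less_cons_code: "x < cons_code x n"
  using le_prod_encode_1[of x n] by (simp add: cons_code_def)

text \<open>
  The fact \<open>(\<sigma>, c, xs, y)\<close> says that program \<open>c\<close> outputs \<open>y\<close> on \<open>xs\<close> when it may only query the
  finite oracle \<open>\<sigma>\<close>, whose entries are listed in reverse so that extending \<open>\<sigma>\<close> is a cons.
  Tags 0 to 6 are the constructors of \<^typ>\<open>recf\<close>. Tag 7 is the search for a homogeneous tree:
  \<open>(\<sigma>, (7, c), xs, y)\<close> says that above \<open>\<sigma>\<close> there is a finite tree with two distinct children at
  each inner node such that \<open>(\<tau>, c, xs, y)\<close> holds at each leaf \<open>\<tau>\<close>. \<open>M\<close> contains the available
  premises.
\<close>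

definition rule_applies :: "nat set \<Rightarrow> nat \<Rightarrow> nat \<Rightarrow> nat \<Rightarrow> nat \<Rightarrow> bool" where
  "rule_applies M \<sigma> c xs y \<longleftrightarrow>
    (let a = fst (prod_decode c); b = snd (prod_decode c);
         b\<^sub>1 = fst (prod_decode b); b\<^sub>2 = snd (prod_decode b) in
      a = 0 \<and> y = 0 \<or>
      a = 1 \<and> xs \<noteq> 0 \<and> tl_code xs = 0 \<and> y = Suc (hd_code xs) \<or>
      a = 2 \<and> drop_code xs b \<noteq> 0 \<and> y = hd_code (drop_code xs b) \<or>
      a = 3 \<and> xs \<noteq> 0 \<and> tl_code xs = 0 \<and> hd_code xs < length (list_decode \<sigma>) \<and>
        y = hd_code (drop_code \<sigma> (length (list_decode \<sigma>) - Suc (hd_code xs))) \<or>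
      a = 4 \<and> (\<exists>ys. fact_code \<sigma> b\<^sub>1 ys y \<in> M \<and> length (list_decode ys) = length (list_decode b\<^sub>2) \<and>
        (\<forall>i<length (list_decode b\<^sub>2).
          fact_code \<sigma> (hd_code (drop_code b\<^sub>2 i)) xs (hd_code (drop_code ys i)) \<in> M)) \<or>
      a = 5 \<and> xs \<noteq> 0 \<and> hd_code xs = 0 \<and> fact_code \<sigma> b\<^sub>1 (tl_code xs) y \<in> M \<or>
      a = 5 \<and> xs \<noteq> 0 \<and> hd_code xs \<noteq> 0 \<and>
        (\<exists>r. fact_code \<sigma> c (cons_code (hd_code xs - 1) (tl_code xs)) r \<in> M \<and>
          fact_code \<sigma> b\<^sub>2 (cons_code (hd_code xs - 1) (cons_code r (tl_code xs))) y \<in> M) \<or>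
      a = 6 \<and> fact_code \<sigma> b (cons_code y xs) 0 \<in> M \<and>
        (\<forall>m<y. \<exists>k. fact_code \<sigma> b (cons_code m xs) (Suc k) \<in> M) \<or>
      a = 7 \<and> fact_code \<sigma> b xs y \<in> M \<or>
      a = 7 \<and> (\<exists>u v. u \<noteq> v \<and> fact_code (cons_code u \<sigma>) c xs y \<in> M \<and>
        fact_code (cons_code v \<sigma>) c xs y \<in> M))"

definition justified :: "nat set \<Rightarrow> nat \<Rightarrow> bool" where
  "justified M x \<longleftrightarrow>
    rule_applies M (fst (prod_decode x)) (fst (prod_decode (snd (prod_decode x))))
      (fst (prod_decode (snd (prod_decode (snd (prod_decode x))))))
      (snd (prod_decode (snd (prod_decode (snd (prod_decode x))))))"

lemma justified_fact_code [simp]: "justified M (fact_code \<sigma> c xs y) = rule_applies M \<sigma> c xs y"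
  by (simp add: justified_def fact_code_def)

text \<open>Premises come only from later entries. This makes soundness an induction on the list and
  every suffix of a derivation a derivation.\<close>

primrec derivation :: "nat list \<Rightarrow> bool" where
  "derivation [] \<longleftrightarrow> True"
| "derivation (x # L) \<longleftrightarrow> justified (set L) x \<and> derivation L"

text \<open>
  The conclusion of a derivation is its head; reading the colour off the head makes it a function
  of the certificate alone.
\<close>

definition colour :: "nat \<Rightarrow> nat" where
  "colour s = snd (prod_decode (snd (prod_decode (snd (prod_decode (hd_code s))))))"

text \<open>This is the self-application: program \<open>n\<close> on input \<open>n\<close>,
  searched from the empty oracle, whose code is 0. Since \<open>colour s\<close> is by definition
  the last component of the head, the equation constrains only the other three.\<close>

definition certificate :: "nat \<Rightarrow> nat \<Rightarrow> bool" where
  "certificate s n \<longleftrightarrow> s \<noteq> 0 \<and> derivation (list_decode s) \<and>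
     hd_code s = fact_code 0 (prod_encode (7, n)) (cons_code n 0) (colour s)"

lemma recfun_fact_code:
  "recfun k A \<Longrightarrow> recfun k B \<Longrightarrow> recfun k C \<Longrightarrow> recfun k D \<Longrightarrow>
   recfun k (\<lambda>xs. fact_code (A xs) (B xs) (C xs) (D xs))"
  unfolding fact_code_def by (intro recfun_prod_encode)

lemma recpred_rule_applies:
  "recpred 5 (\<lambda>xs. rule_applies (set (list_decode (xs ! 0))) (xs ! 1) (xs ! 2) (xs ! 3) (xs ! 4))"
proof -
  note intros = recursive_intros recfun_length_list_decode recpred_in_list_decode recfun_fact_code
  \<comment> \<open>Existentials occur at two depths: \<open>ys\<close>, \<open>r\<close>,
    \<open>u\<close> at the top, and \<open>k\<close>, \<open>v\<close> under one further binder.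
    The bound is the code of the premise list in both cases, shifted by one position in
    \<open>ex1\<close>.\<close>
  have ex0: "recpred (Suc 5) (\<lambda>ys. P (ys ! 0) (tl ys)) \<Longrightarrow>
      (\<And>i xs. P i xs \<Longrightarrow> i < xs ! 0) \<Longrightarrow> recpred 5 (\<lambda>xs. \<exists>i. P i xs)" for P
    by (rule recpred_ex[where B = "\<lambda>xs. xs ! 0"]) (auto intro: recfun_nth)
  have ex1: "recpred (Suc (Suc 5)) (\<lambda>ys. P (ys ! 0) (tl ys)) \<Longrightarrow>
      (\<And>i xs. P i xs \<Longrightarrow> i < tl xs ! 0) \<Longrightarrow> recpred (Suc 5) (\<lambda>xs. \<exists>i. P i xs)" for P
    by (rule recpred_ex[where B = "\<lambda>xs. tl xs ! 0"]) (auto intro: recfun_tl_nth)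
  show ?thesis
    unfolding rule_applies_def Let_def
    by (intro intros ex0 ex1)
      (auto dest: fact_code_less intro: less_trans[OF less_cons_code])
qed

lemma recpred_justified:
  "recpred 2 (\<lambda>xs. justified (set (list_decode (xs ! 0))) (xs ! 1))"
  unfolding justified_def
  by (intro recpred_comp5[where P = "\<lambda>t. rule_applies (set (list_decode t))",
        OF recpred_rule_applies] recursive_intros) auto

lemma derivation_iff_nth:
  "derivation L \<longleftrightarrow> (\<forall>k<length L. justified (set (drop (Suc k) L)) (L ! k))"
proof (induction L)
  case (Cons x L)
  then show ?case by (auto simp: All_less_Suc2)
qed simp

lemma recpred_derivation: "recfun k A \<Longrightarrow> recpred k (\<lambda>xs. derivation (list_decode (A xs)))"
proof (rule recpred_comp1[where P = "\<lambda>s. derivation (list_decode s)"])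
  have "derivation (list_decode s) \<longleftrightarrow> (\<forall>k<length (list_decode s).
      justified (set (list_decode (tl_code (drop_code s k)))) (hd_code (drop_code s k)))" for s
  proof -
    obtain L where "s = list_encode L" by (metis list_decode_inverse)
    then show ?thesis by (simp add: derivation_iff_nth drop_Suc tl_drop)
  qed
  moreover have "recpred 1 (\<lambda>xs. \<forall>k<length (list_decode (xs ! 0)).
      justified (set (list_decode (tl_code (drop_code (xs ! 0) k)))) (hd_code (drop_code (xs ! 0) k)))"
    by (intro recursive_intros recfun_length_list_decode
        recpred_comp2[where P = "\<lambda>t. justified (set (list_decode t))", OF recpred_justified]) auto
  ultimately show "recpred 1 (\<lambda>xs. derivation (list_decode (xs ! 0)))" by simp
qed

lemma recfun_colour: "recfun k A \<Longrightarrow> recfun k (\<lambda>xs. colour (A xs))"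
  unfolding colour_def by (intro recursive_intros)

lemma recpred_certificate:
  "recfun k A \<Longrightarrow> recfun k B \<Longrightarrow> recpred k (\<lambda>xs. certificate (A xs) (B xs))"
  unfolding certificate_def
  by (intro recursive_intros recpred_derivation recfun_fact_code recfun_colour)

section \<open>The computable tree of the diagonal class\<close>

text \<open>Bounding the stage \<open>s\<close> by the length makes membership decidable, although
  the existence of a certificate need not be; a bad value is detected once the node is long enough.
  Using only the first certificate forbids at most one value at each \<open>n\<close>.\<close>

definition diag_tree :: "nat list set" where
  "diag_tree = {\<sigma>. \<forall>n<length \<sigma>. \<forall>s<length \<sigma>.
     certificate s n \<and> (\<forall>s'<s. \<not> certificate s' n) \<longrightarrow> \<sigma> ! n \<noteq> colour s}"

lemma computable_tree_diag_tree: "computable_tree diag_tree"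
  unfolding computable_tree_def
proof
  show "tree diag_tree"
    unfolding tree_def
  proof (intro ballI allI impI)
    fix \<sigma> \<tau> assume "\<sigma> \<in> diag_tree" "prefix \<tau> \<sigma>"
    moreover have "\<sigma> ! n = \<tau> ! n" if "n < length \<tau>" for n
      using \<open>prefix \<tau> \<sigma>\<close> that by (auto simp: prefix_def nth_append)
    ultimately show "\<tau> \<in> diag_tree"
      unfolding diag_tree_def mem_Collect_eq using prefix_length_le
      by (metis order_less_le_trans)
  qed
  have "recpred 1 (\<lambda>xs. \<forall>n<length (list_decode (xs ! 0)). \<forall>s<length (list_decode (xs ! 0)).
      certificate s n \<and> (\<forall>s'<s. \<not> certificate s' n) \<longrightarrow> hd_code (drop_code (xs ! 0) n) \<noteq> colour s)"
    by (intro recursive_intros recfun_length_list_decode recpred_certificate recfun_colour) auto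
  moreover have "(m \<in> list_encode ` diag_tree) \<longleftrightarrow>
      (\<forall>n<length (list_decode m). \<forall>s<length (list_decode m).
        certificate s n \<and> (\<forall>s'<s. \<not> certificate s' n) \<longrightarrow> hd_code (drop_code m n) \<noteq> colour s)" for m
  proof -
    obtain L where m: "m = list_encode L" by (metis list_decode_inverse)
    have "m \<in> list_encode ` diag_tree \<longleftrightarrow> L \<in> diag_tree"
      unfolding m by (auto dest: injD[OF inj_list_encode])
    then show ?thesis
      unfolding m by (simp add: diag_tree_def)
  qed
  ultimately have "recpred 1 (\<lambda>xs. xs ! 0 \<in> list_encode ` diag_tree)"
    by simp
  then show "computable (\<lambda>n. of_bool (n \<in> list_encode ` diag_tree))"
    unfolding recpred_def recfun_def computable_def
    by (metis length_0_conv length_Suc_conv nth_Cons_0 One_nat_def)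
qed

section \<open>Completeness and soundness of derivations for oracle programs\<close>

definition derivable :: "nat \<Rightarrow> nat \<Rightarrow> nat \<Rightarrow> nat \<Rightarrow> bool" where
  "derivable \<sigma> c xs y \<longleftrightarrow> (\<exists>L. derivation L \<and> fact_code \<sigma> c xs y \<in> set L)"

text \<open>\<open>M\<close> occurs only positively in the rules. Hence derivations can be
  concatenated, and those of finitely many premises pooled.\<close>

lemma rule_applies_mono:
  assumes "rule_applies M \<sigma> c xs y" "M \<subseteq> N"
  shows "rule_applies N \<sigma> c xs y"
  using assms(1) unfolding rule_applies_def Let_def
  by (elim disj_forward) (use assms(2) in blast)+

lemma derivation_append: "derivation L \<Longrightarrow> derivation L' \<Longrightarrow> derivation (L @ L')"
proof (induction L)
  case (Cons x L)
  have "justified (set (L @ L')) x" if "justified (set L) x"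
    using that unfolding justified_def by (rule rule_applies_mono) simp
  with Cons show ?case by simp
qed simp

lemma derivation_finite_union:
  assumes "finite F" "\<And>x. x \<in> F \<Longrightarrow> \<exists>L. derivation L \<and> x \<in> set L"
  shows "\<exists>L. derivation L \<and> F \<subseteq> set L"
  using assms
proof (induction F)
  case empty
  show ?case by (rule exI[of _ "[]"]) simp
next
  case (insert x F)
  then obtain L L' where "derivation L" "F \<subseteq> set L" "derivation L'" "x \<in> set L'"
    by (metis insertCI)
  then show ?case
    using derivation_append by (intro exI[of _ "L @ L'"]) auto
qed

lemma derivable_step:
  assumes "rule_applies F \<sigma> c xs y" "finite F"
    and "\<And>x. x \<in> F \<Longrightarrow> \<exists>L. derivation L \<and> x \<in> set L"
  shows "derivable \<sigma> c xs y"
proof -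
  obtain L where L: "derivation L" "F \<subseteq> set L"
    using derivation_finite_union assms(2,3) by blast
  have "rule_applies (set L) \<sigma> c xs y"
    using assms(1) L(2) by (rule rule_applies_mono)
  then show ?thesis
    unfolding derivable_def using L(1) by (intro exI[of _ "fact_code \<sigma> c xs y # L"]) simp
qed

primrec code :: "recf \<Rightarrow> nat" where
  "code Zero = prod_encode (0, 0)"
| "code Succ = prod_encode (1, 0)"
| "code (Proj i) = prod_encode (2, i)"
| "code Oracle = prod_encode (3, 0)"
| "code (Comp f hs) = prod_encode (4, prod_encode (code f, list_encode (map code hs)))"
| "code (PrimRec f h) = prod_encode (5, prod_encode (code f, code h))"
| "code (Mu f) = prod_encode (6, code f)"

definition seg :: "(nat \<Rightarrow> nat) \<Rightarrow> nat \<Rightarrow> nat list" where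
  "seg g m = rev (map g [0..<m])"

lemma length_seg [simp]: "length (seg g m) = m"
  by (simp add: seg_def)

lemma seg_0 [simp]: "seg g 0 = []"
  by (simp add: seg_def)

lemma seg_Suc: "seg g (Suc m) = g m # seg g m"
  by (simp add: seg_def)

lemma seg_cong: "(\<And>i. i < m \<Longrightarrow> g i = g' i) \<Longrightarrow> seg g m = seg g' m"
  by (simp add: seg_def)

text \<open>The reversed position is the one that the oracle rule (tag 3) looks up.\<close>

lemma seg_nth: "x < m \<Longrightarrow> seg g m ! (m - Suc x) = g x"
  by (simp add: seg_def rev_nth)

lemma those_eq_Some_iff: "those xs = Some ys \<longleftrightarrow> xs = map Some ys"
  by (induction xs arbitrary: ys) (auto split: option.splits simp: Cons_eq_map_conv)

lemma eval_Mu_eq_Some_iff: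
  "eval (Mu f) g xs = Some n \<longleftrightarrow>
     eval f g (n # xs) = Some 0 \<and> (\<forall>m<n. \<exists>k. eval f g (m # xs) = Some (Suc k))"
proof -
  have "(LEAST n. eval f g (n # xs) = Some 0) = n"
    if "eval f g (n # xs) = Some 0" "\<forall>m<n. \<exists>k. eval f g (m # xs) = Some (Suc k)" for n
  proof (rule Least_equality)
    fix m assume "eval f g (m # xs) = Some 0"
    then show "n \<le> m"
      using that(2) by (metis not_less option.inject old.nat.distinct(2))
  qed (rule that(1))
  then show ?thesis by auto
qed

text \<open>Induction on the program: a convergent computation asks finitely many queries. Stating
  this for all large \<open>m\<close> lets the thresholds of finitely many subcomputations be
  combined.\<close>

lemma code_complete:
  "eval r g xs = Some y \<Longrightarrow>
   \<forall>\<^sub>F m in sequentially. derivable (list_encode (seg g m)) (code r) (list_encode xs) y"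
proof (induction r arbitrary: xs y)
  case Zero
  then show ?case
    by (intro always_eventually allI derivable_step[where F = "{}"])
      (auto simp: rule_applies_def Let_def)
next
  case Succ
  then show ?case
    by (intro always_eventually allI derivable_step[where F = "{}"])
      (auto simp: rule_applies_def Let_def split: list.splits)
next
  case (Proj i)
  then show ?case
    by (intro always_eventually allI derivable_step[where F = "{}"])
      (auto simp: rule_applies_def Let_def split: if_splits)
next
  case Oracle
  then obtain x where xs: "xs = [x]" and y: "y = g x"
    by (auto split: list.splits)
  have "derivable (list_encode (seg g m)) (code Oracle) (list_encode xs) y" if "x < m" for m
    using that unfolding xs y
    by (intro derivable_step[where F = "{}"]) (auto simp: rule_applies_def Let_def seg_nth)
  then show ?case
    using eventually_gt_at_top[of x] by (rule eventually_mono[rotated])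
next
  case (Comp f hs)
  then obtain ys where ys: "map (\<lambda>h. eval h g xs) hs = map Some ys" and y: "eval f g ys = Some y"
    by (auto simp: bind_eq_Some_conv those_eq_Some_iff)
  have len: "length ys = length hs"
    using map_eq_imp_length_eq[OF ys] by simp
  have "eval (hs ! i) g xs = Some (ys ! i)" if "i < length hs" for i
    using arg_cong[OF ys, of "\<lambda>zs. zs ! i"] that len by simp
  then have "\<forall>\<^sub>F m in sequentially. \<forall>i\<in>{..<length hs}.
      derivable (list_encode (seg g m)) (code (hs ! i)) (list_encode xs) (ys ! i)"
    using Comp.IH(2) by (intro eventually_ball_finite) auto
  then show ?case
    using Comp.IH(1)[OF y]
  proof eventually_elim
    case (elim m)
    let ?\<sigma> = "list_encode (seg g m)"
    let ?F = "insert (fact_code ?\<sigma> (code f) (list_encode ys) y)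
      ((\<lambda>i. fact_code ?\<sigma> (code (hs ! i)) (list_encode xs) (ys ! i)) ` {..<length hs})"
    have "rule_applies ?F ?\<sigma> (code (Comp f hs)) (list_encode xs) y"
      unfolding rule_applies_def Let_def using len
      by (auto intro!: exI[of _ "list_encode ys"])
    then show ?case
      by (rule derivable_step) (use elim in \<open>auto simp: derivable_def\<close>)
  qed
next
  case (PrimRec f h)
  then obtain n zs where xs: "xs = n # zs"
    by (auto split: list.splits)
  have "eval (PrimRec f h) g (n # zs) = Some y \<Longrightarrow> \<forall>\<^sub>F m in sequentially.
      derivable (list_encode (seg g m)) (code (PrimRec f h)) (list_encode (n # zs)) y"
  proof (induction n arbitrary: y)
    case 0
    then have "eval f g zs = Some y" by simp
    from PrimRec.IH(1)[OF this] show ?case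
    proof eventually_elim
      case (elim m)
      let ?\<sigma> = "list_encode (seg g m)"
      have "rule_applies {fact_code ?\<sigma> (code f) (list_encode zs) y} ?\<sigma> (code (PrimRec f h))
          (list_encode (0 # zs)) y"
        by (simp add: rule_applies_def Let_def)
      then show ?case
        by (rule derivable_step) (use elim in \<open>auto simp: derivable_def\<close>)
    qed
  next
    case (Suc n)
    then obtain z where z: "eval (PrimRec f h) g (n # zs) = Some z"
      and y: "eval h g (n # z # zs) = Some y"
      by (auto simp: bind_eq_Some_conv)
    from Suc.IH[OF z] PrimRec.IH(2)[OF y] show ?case
    proof eventually_elim
      case (elim m)
      let ?\<sigma> = "list_encode (seg g m)"
      have "rule_applies {fact_code ?\<sigma> (code (PrimRec f h)) (list_encode (n # zs)) z,
          fact_code ?\<sigma> (code h) (list_encode (n # z # zs)) y} ?\<sigma> (code (PrimRec f h))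
          (list_encode (Suc n # zs)) y"
        by (auto simp: rule_applies_def Let_def)
      then show ?case
        by (rule derivable_step) (use elim in \<open>auto simp: derivable_def\<close>)
    qed
  qed
  then show ?case
    using PrimRec.prems xs by simp
next
  case (Mu f)
  then have n: "eval f g (y # xs) = Some 0"
    "\<And>m. m < y \<Longrightarrow> \<exists>k. eval f g (m # xs) = Some (Suc k)"
    unfolding eval_Mu_eq_Some_iff by auto
  obtain k where k: "\<And>m. m < y \<Longrightarrow> eval f g (m # xs) = Some (Suc (k m))"
    using n(2) by metis
  have "\<forall>\<^sub>F m in sequentially. \<forall>i\<in>{..<y}.
      derivable (list_encode (seg g m)) (code f) (list_encode (i # xs)) (Suc (k i))"
    using Mu.IH k by (intro eventually_ball_finite) auto
  then show ?case
    using Mu.IH[OF n(1)]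
  proof eventually_elim
    case (elim m)
    let ?\<sigma> = "list_encode (seg g m)"
    let ?F = "insert (fact_code ?\<sigma> (code f) (list_encode (y # xs)) 0)
      ((\<lambda>i. fact_code ?\<sigma> (code f) (list_encode (i # xs)) (Suc (k i))) ` {..<y})"
    have "rule_applies ?F ?\<sigma> (code (Mu f)) (list_encode xs) y"
      unfolding rule_applies_def Let_def by auto
    then show ?case
      by (rule derivable_step) (use elim in \<open>auto simp: derivable_def\<close>)
  qed
qed

text \<open>Induction on the list, as the premises of the head lie in the tail. The rules with tags
  0 to 6 leave the oracle segment fixed, and tag 7 cannot apply because it is never the tag of
  \<open>code r\<close>.\<close>

lemma code_sound_list:
  assumes "derivation L" "fact_code (list_encode (seg g m)) (code r) (list_encode xs) y \<in> set L"
  shows "eval r g xs = Some y"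
  using assms
proof (induction L arbitrary: r xs y)
  case (Cons x L)
  let ?\<sigma> = "list_encode (seg g m)"
  have IH: "fact_code ?\<sigma> (code r) (list_encode xs) y \<in> set L \<Longrightarrow> eval r g xs = Some y" for r xs y
    using Cons by simp
  show ?case
  proof (cases "fact_code ?\<sigma> (code r) (list_encode xs) y \<in> set L")
    case False
    with Cons.prems have R: "rule_applies (set L) ?\<sigma> (code r) (list_encode xs) y"
      by auto
    show ?thesis
    proof (cases r)
      case Zero
      then show ?thesis using R by (simp add: rule_applies_def Let_def)
    next
      case Succ
      then show ?thesis
        using R by (cases xs) (auto simp: rule_applies_def Let_def split: list.splits)
    next
      case (Proj i)
      then show ?thesis using R by (auto simp: rule_applies_def Let_def)
    next
      case Oracle
      then show ?thesis
        using R by (cases xs) (auto simp: rule_applies_def Let_def seg_nth split: list.splits)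
    next
      case (Comp f hs)
      obtain n where "fact_code ?\<sigma> (code f) n y \<in> set L" "length (list_decode n) = length hs"
        "\<forall>i<length hs. fact_code ?\<sigma> (code (hs ! i)) (list_encode xs) (hd_code (drop_code n i)) \<in> set L"
        using R by (auto simp: Comp rule_applies_def)
      moreover obtain ys where "n = list_encode ys" by (metis list_decode_inverse)
      ultimately have ys: "eval f g ys = Some y" "length ys = length hs"
        "\<And>i. i < length hs \<Longrightarrow> eval (hs ! i) g xs = Some (ys ! i)"
        using IH by auto
      then have "map (\<lambda>h. eval h g xs) hs = map Some ys"
        by (intro nth_equalityI) auto
      then show ?thesis
        using ys(1) by (simp add: Comp those_eq_Some_iff[THEN iffD2])
    next
      case (PrimRec f h)
      then obtain n zs where xs: "xs = n # zs"
        using R by (cases xs) (auto simp: rule_applies_def Let_def)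
      show ?thesis
      proof (cases n)
        case 0
        then show ?thesis
          using R IH by (auto simp: rule_applies_def Let_def PrimRec xs)
      next
        case (Suc k)
        then obtain z where z: "fact_code ?\<sigma> (code r) (list_encode (k # zs)) z \<in> set L"
          "fact_code ?\<sigma> (code h) (list_encode (k # z # zs)) y \<in> set L"
          using R by (auto simp: rule_applies_def Let_def PrimRec xs)
        show ?thesis
          using IH[OF z(1)] IH[OF z(2)] by (simp add: PrimRec xs Suc)
      qed
    next
      case (Mu f)
      then have "fact_code ?\<sigma> (code f) (list_encode (y # xs)) 0 \<in> set L"
        and "\<forall>m<y. \<exists>k. fact_code ?\<sigma> (code f) (list_encode (m # xs)) (Suc k) \<in> set L"
        using R by (auto simp: rule_applies_def Let_def)
      then have y: "eval f g (y # xs) = Some 0" "\<forall>m<y. \<exists>k. eval f g (m # xs) = Some (Suc k)"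
        using IH by blast+
      then show ?thesis
        unfolding Mu eval_Mu_eq_Some_iff by blast
    qed
  qed (rule IH)
qed simp

lemma code_sound:
  "derivable (list_encode (seg g m)) (code r) (list_encode xs) y \<Longrightarrow> eval r g xs = Some y"
  unfolding derivable_def using code_sound_list by blast

text \<open>The use principle: completeness gives a derivation over a finite segment of
  \<open>g\<close>, and soundness reads it for any \<open>g'\<close> with the same segment.\<close>

lemma eval_finite_use:
  assumes "eval r g xs = Some y"
  obtains m where "\<And>g'. (\<And>i. i < m \<Longrightarrow> g' i = g i) \<Longrightarrow> eval r g' xs = Some y"
proof -
  obtain m where "derivable (list_encode (seg g m)) (code r) (list_encode xs) y"
    using eventually_happens'[OF _ code_complete[OF assms]] by auto
  then show ?thesis
    using that[of m] seg_cong[of m] code_sound by metis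
qed

lemma derivation_appendD: "derivation (L @ L') \<Longrightarrow> derivation L'"
  by (induction L) auto

section \<open>Homogeneous trees: soundness and completeness of the search\<close>

lemma derivable_homogeneous_leaf:
  assumes "derivable \<sigma> c xs y"
  shows "derivable \<sigma> (prod_encode (7, c)) xs y"
proof (rule derivable_step)
  show "rule_applies {fact_code \<sigma> c xs y} \<sigma> (prod_encode (7, c)) xs y"
    by (simp add: rule_applies_def Let_def)
qed (use assms in \<open>auto simp: derivable_def\<close>)

lemma derivable_homogeneous_branch:
  assumes "u \<noteq> v" "derivable (cons_code u \<sigma>) (prod_encode (7, c)) xs y"
    "derivable (cons_code v \<sigma>) (prod_encode (7, c)) xs y"
  shows "derivable \<sigma> (prod_encode (7, c)) xs y"
proof (rule derivable_step)
  let ?F = "{fact_code (cons_code u \<sigma>) (prod_encode (7, c)) xs y,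
    fact_code (cons_code v \<sigma>) (prod_encode (7, c)) xs y}"
  show "rule_applies ?F \<sigma> (prod_encode (7, c)) xs y"
    unfolding rule_applies_def Let_def using assms(1)
    by (intro disjI2 conjI exI[of _ u] exI[of _ v]) simp_all
qed (use assms in \<open>auto simp: derivable_def\<close>)

text \<open>Follow the tree upwards while avoiding \<open>p\<close>: two distinct children cannot
  both equal \<open>p m\<close>, so one of them can always be taken until a leaf is reached.\<close>

lemma homogeneous_sound:
  assumes "derivation L"
    "fact_code (list_encode (seg g m)) (prod_encode (7, code r)) (list_encode xs) y \<in> set L"
    "\<And>i. i < m \<Longrightarrow> g i \<noteq> p i"
  shows "\<exists>g'. (\<forall>i. g' i \<noteq> p i) \<and> eval r g' xs = Some y"
  using assms
proof (induction L arbitrary: g m)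
  case (Cons x L)
  let ?c = "prod_encode (7, code r)"
  have IH: "\<exists>g'. (\<forall>i. g' i \<noteq> p i) \<and> eval r g' xs = Some y"
    if "fact_code (list_encode (seg g m)) ?c (list_encode xs) y \<in> set L" "\<And>i. i < m \<Longrightarrow> g i \<noteq> p i"
    for g m
    using Cons.IH[of g m] Cons.prems(1) that by simp
  show ?case
  proof (cases "fact_code (list_encode (seg g m)) ?c (list_encode xs) y \<in> set L")
    case True
    then show ?thesis using IH Cons.prems(3) by blast
  next
    case False
    with Cons.prems have "rule_applies (set L) (list_encode (seg g m)) ?c (list_encode xs) y"
      by auto
    then consider (leaf) "fact_code (list_encode (seg g m)) (code r) (list_encode xs) y \<in> set L"
      | (branch) u v where "u \<noteq> v"
        "fact_code (list_encode (u # seg g m)) ?c (list_encode xs) y \<in> set L"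
        "fact_code (list_encode (v # seg g m)) ?c (list_encode xs) y \<in> set L"
      unfolding rule_applies_def Let_def by auto
    then show ?thesis
    proof cases
      case leaf
      \<comment> \<open>Past the leaf, \<open>Suc (p i)\<close> continues to avoid \<open>p\<close>;
        the segment below \<open>m\<close>, which fixes the value, is unchanged.\<close>
      define g' where "g' i = (if i < m then g i else Suc (p i))" for i
      have "seg g' m = seg g m"
        by (rule seg_cong) (simp add: g'_def)
      then have "eval r g' xs = Some y"
        using code_sound_list[of L g' m] Cons.prems(1) leaf by simp
      moreover have "\<forall>i. g' i \<noteq> p i"
        using Cons.prems(3) by (simp add: g'_def)
      ultimately show ?thesis by blast
    next
      case branch
      then obtain w where w: "w \<noteq> p m"
        "fact_code (list_encode (w # seg g m)) ?c (list_encode xs) y \<in> set L"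
        by metis
      define g' where "g' = g(m := w)"
      have "seg g' m = seg g m"
        by (rule seg_cong) (simp add: g'_def)
      then have "seg g' (Suc m) = w # seg g m"
        by (simp add: seg_Suc g'_def)
      moreover have "g' i \<noteq> p i" if "i < Suc m" for i
        using that w(1) Cons.prems(3) by (auto simp: g'_def less_Suc_eq)
      ultimately show ?thesis
        using IH[of g' "Suc m"] w(2) by simp
    qed
  qed
qed simp

text \<open>Dependent choice along finite sequences. It supplies both the avoiding path in
  \<open>homogeneous_complete\<close> and the path of Koenig's lemma in the compactness
  argument.\<close>

lemma path_exists:
  assumes "R []" "\<And>\<sigma>. R \<sigma> \<Longrightarrow> \<exists>a. R (a # \<sigma>) \<and> S (length \<sigma>) a"
  shows "\<exists>g. \<forall>m. R (seg g m) \<and> S m (g m)"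
proof -
  obtain nxt where n: "\<And>\<sigma>. R \<sigma> \<Longrightarrow> R (nxt \<sigma> # \<sigma>) \<and> S (length \<sigma>) (nxt \<sigma>)"
    using assms(2) by metis
  define \<tau> where "\<tau> m = rec_nat [] (\<lambda>_ \<sigma>. nxt \<sigma> # \<sigma>) m" for m :: nat
  define g where "g m = nxt (\<tau> m)" for m
  have \<tau>: "\<tau> 0 = []" "\<tau> (Suc m) = nxt (\<tau> m) # \<tau> m" for m
    by (simp_all add: \<tau>_def)
  have "seg g m = \<tau> m" for m
    by (induction m) (simp_all add: \<tau> seg_Suc g_def)
  moreover have "R (\<tau> m)" for m
    by (induction m) (use assms(1) n in \<open>auto simp: \<tau>\<close>)
  ultimately have "R (seg g m) \<and> S m (g m)" for m
    using n[of "\<tau> m"] length_seg[of g m] by (simp add: g_def)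
  then show ?thesis by blast
qed

lemma homogeneous_complete:
  assumes Y: "finite Y"
    and val: "\<And>g. (\<And>i. g i \<noteq> p i) \<Longrightarrow> \<exists>y\<in>Y. eval r g xs = Some y"
  shows "\<exists>y. derivable 0 (prod_encode (7, code r)) (list_encode xs) y"
proof (rule ccontr)
  let ?D = "\<lambda>\<sigma> y. derivable (list_encode \<sigma>) (prod_encode (7, code r)) (list_encode xs) y"
  assume none: "\<not> ?thesis"
  have "\<exists>g. \<forall>m. (\<forall>y\<in>Y. \<not> ?D (seg g m) y) \<and> g m \<noteq> p m"
  proof (rule path_exists[where R = "\<lambda>\<sigma>. \<forall>y\<in>Y. \<not> ?D \<sigma> y" and S = "\<lambda>m a. a \<noteq> p m"])
    show "\<forall>y\<in>Y. \<not> ?D [] y" using none by simp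
    fix \<sigma> assume \<sigma>: "\<forall>y\<in>Y. \<not> ?D \<sigma> y"
    show "\<exists>a. (\<forall>y\<in>Y. \<not> ?D (a # \<sigma>) y) \<and> a \<noteq> p (length \<sigma>)"
    proof (rule ccontr)
      let ?A = "UNIV - {p (length \<sigma>)}"
      assume "\<not> ?thesis"
      then have "\<forall>a\<in>?A. \<exists>y\<in>Y. ?D (a # \<sigma>) y" by blast
      then obtain col where col: "\<And>a. a \<in> ?A \<Longrightarrow> col a \<in> Y \<and> ?D (a # \<sigma>) (col a)"
        by metis
      \<comment> \<open>Finitely many colours on infinitely many avoiding children: two children
        share a colour, and their trees join to one at the parent.\<close>
      have "finite (col ` ?A)"
        using col Y by (meson finite_subset image_subsetI)
      moreover have "infinite ?A"
        by (simp add: infinite_UNIV_nat)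
      ultimately have "\<not> inj_on col ?A"
        using finite_imageD by blast
      then obtain u v where uv: "u \<in> ?A" "v \<in> ?A" "u \<noteq> v" "col v = col u"
        unfolding inj_on_def by metis
      have "?D \<sigma> (col u)"
        using derivable_homogeneous_branch[OF uv(3), of "list_encode \<sigma>"]
          col[OF uv(1)] col[OF uv(2)] uv(4) by simp
      then show False
        using \<sigma> col[OF uv(1)] by blast
    qed
  qed
  then obtain g where g: "\<And>m y. y \<in> Y \<Longrightarrow> \<not> ?D (seg g m) y" "\<And>m. g m \<noteq> p m"
    by blast
  \<comment> \<open>Since \<open>g\<close> avoids \<open>p\<close>, the program converges on it
    within some finite segment, and that segment alone is a tree consisting of a leaf.\<close>
  obtain y where "y \<in> Y" "eval r g xs = Some y"
    using val g(2) by blast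
  then obtain m where "derivable (list_encode (seg g m)) (code r) (list_encode xs) y"
    using eventually_happens'[OF _ code_complete] by fastforce
  then show False
    using derivable_homogeneous_leaf g(1) \<open>y \<in> Y\<close> by blast
qed

section \<open>Composition of Turing functionals\<close>

text \<open>
  \<^const>\<open>Oracle\<close> diverges on inputs of the wrong length whereas \<open>d\<close> need not, so substitution may
  turn divergence into convergence; only one direction holds in the lemma below.
\<close>

primrec subst_oracle :: "recf \<Rightarrow> recf \<Rightarrow> recf" where
  "subst_oracle d Zero = Zero"
| "subst_oracle d Succ = Succ"
| "subst_oracle d (Proj i) = Proj i"
| "subst_oracle d Oracle = d"
| "subst_oracle d (Comp f hs) = Comp (subst_oracle d f) (map (subst_oracle d) hs)"
| "subst_oracle d (PrimRec f h) = PrimRec (subst_oracle d f) (subst_oracle d h)"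
| "subst_oracle d (Mu f) = Mu (subst_oracle d f)"

lemma eval_subst_oracle:
  assumes d: "\<And>x. eval d g [x] = Some (h x)"
  shows "eval r h xs = Some y \<Longrightarrow> eval (subst_oracle d r) g xs = Some y"
proof (induction r arbitrary: xs y)
  case Oracle
  then show ?case by (auto simp: d split: list.splits)
next
  case (Comp f hs)
  then obtain ys where ys: "map (\<lambda>e. eval e h xs) hs = map Some ys" and y: "eval f h ys = Some y"
    by (auto simp: bind_eq_Some_conv those_eq_Some_iff)
  have len: "length ys = length hs"
    using map_eq_imp_length_eq[OF ys] by simp
  have "eval (hs ! i) h xs = Some (ys ! i)" if "i < length hs" for i
    using arg_cong[OF ys, of "\<lambda>zs. zs ! i"] that len by simp
  then have "map (\<lambda>e. eval e g xs) (map (subst_oracle d) hs) = map Some ys"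
    using Comp.IH(2) len by (intro nth_equalityI) auto
  then have "those (map (\<lambda>e. eval e g xs) (map (subst_oracle d) hs)) = Some ys"
    by (simp only: those_eq_Some_iff)
  then show ?case
    using Comp.IH(1)[OF y] by (simp only: subst_oracle.simps eval.simps bind.simps)
next
  case (PrimRec f e)
  then obtain n zs where xs: "xs = n # zs"
    by (auto split: list.splits)
  have "eval (PrimRec f e) h (n # zs) = Some y \<Longrightarrow>
    eval (subst_oracle d (PrimRec f e)) g (n # zs) = Some y"
    using PrimRec.IH by (induction n arbitrary: y) (auto simp: bind_eq_Some_conv)
  then show ?case
    using PrimRec.prems xs by simp
next
  case (Mu f)
  then show ?case
    unfolding subst_oracle.simps eval_Mu_eq_Some_iff by blast
qed auto

section \<open>Compactness of Cantor space\<close>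

text \<open>Induction over the generation of \<open>U\<close>: the length of the sequence serves for
  a cylinder, the maximum for an intersection.\<close>

lemma openin_sequence_space_agree:
  assumes "openin (sequence_space A) U" "p \<in> U"
  shows "\<exists>m. \<forall>q. range q \<subseteq> A \<longrightarrow> (\<forall>i<m. q i = p i) \<longrightarrow> q \<in> U"
proof -
  have "generate_topology_on {cylinder A \<sigma> |\<sigma>. set \<sigma> \<subseteq> A} U"
    using assms(1) unfolding sequence_space_def by (simp add: openin_topology_generated_by_iff)
  then show ?thesis
    using assms(2)
  proof (induction)
    case (Int a b)
    then obtain m n where "\<forall>q. range q \<subseteq> A \<longrightarrow> (\<forall>i<m. q i = p i) \<longrightarrow> q \<in> a"
      "\<forall>q. range q \<subseteq> A \<longrightarrow> (\<forall>i<n. q i = p i) \<longrightarrow> q \<in> b"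
      by blast
    then show ?case by (intro exI[of _ "max m n"]) auto
  next
    case (UN K)
    then show ?case by (meson UnionE UnionI)
  next
    case (Basis s)
    then obtain \<sigma> where s: "s = cylinder A \<sigma>" by blast
    have "q \<in> s" if "range q \<subseteq> A" "\<forall>i<length \<sigma>. q i = p i" for q
    proof -
      have "map q [0..<length \<sigma>] = map p [0..<length \<sigma>]"
        using that(2) by simp
      then show ?thesis
        using that(1) Basis(2) unfolding s cylinder_def by (simp del: map_eq_conv)
    qed
    then show ?case by blast
  qed simp
qed

text \<open>Leaving the tree is witnessed by a finite segment, so the complement is a union of
  cylinders.\<close>

lemma closedin_baire_space_paths: "closedin baire_space (paths T)"
proof -
  have "topspace baire_space - paths T = \<Union> {cylinder UNIV \<sigma> |\<sigma>. \<sigma> \<notin> T}"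
  proof (intro equalityI subsetI)
    fix f assume "f \<in> topspace baire_space - paths T"
    then obtain n where "map f [0..<n] \<notin> T" by (auto simp: paths_def)
    moreover have "f \<in> cylinder UNIV (map f [0..<n])" by (simp add: cylinder_def)
    ultimately show "f \<in> \<Union> {cylinder UNIV \<sigma> |\<sigma>. \<sigma> \<notin> T}" by blast
  next
    fix f assume "f \<in> \<Union> {cylinder UNIV \<sigma> |\<sigma>. \<sigma> \<notin> T}"
    then obtain \<sigma> where "\<sigma> \<notin> T" "map f [0..<length \<sigma>] = \<sigma>" by (auto simp: cylinder_def)
    then have "f \<notin> paths T" unfolding paths_def by (metis (mono_tags, lifting) mem_Collect_eq)
    then show "f \<in> topspace baire_space - paths T" by (simp add: topspace_sequence_space)
  qed
  moreover have "openin baire_space (\<Union> {cylinder UNIV \<sigma> |\<sigma>. \<sigma> \<notin> T})"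
    unfolding sequence_space_def by (intro openin_Union) (auto intro: topology_generated_by_Basis)
  ultimately show ?thesis
    by (simp add: closedin_def topspace_sequence_space)
qed

text \<open>Koenig's lemma: infinitely many values would persist along some binary path
  \<open>g\<close>. Closedness puts \<open>g\<close> into \<open>P\<close>, but the finite use of
  the computation at \<open>g\<close> leaves just one value near \<open>g\<close>.\<close>

lemma finite_values_on_cantor_closed:
  assumes P: "closedin cantor_space P" and total: "\<And>p. p \<in> P \<Longrightarrow> eval r p xs \<noteq> None"
  shows "finite {y. \<exists>p\<in>P. eval r p xs = Some y}"
proof (rule ccontr)
  let ?V = "\<lambda>\<sigma>. {y. \<exists>p\<in>P. seg p (length \<sigma>) = \<sigma> \<and> eval r p xs = Some y}"
  have range: "range p \<subseteq> {0, 1}" if "p \<in> P" for p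
    using subsetD[OF closedin_subset[OF P] that] unfolding topspace_sequence_space mem_Collect_eq .
  assume inf: "infinite {y. \<exists>p\<in>P. eval r p xs = Some y}"
  have "\<exists>g. \<forall>m. infinite (?V (seg g m)) \<and> g m \<in> {0, 1}"
  proof (rule path_exists[where R = "\<lambda>\<sigma>. infinite (?V \<sigma>)" and S = "\<lambda>m a. a \<in> {0, 1}"])
    show "infinite (?V [])" using inf by simp
    fix \<sigma> assume \<sigma>: "infinite (?V \<sigma>)"
    have "?V \<sigma> \<subseteq> ?V (0 # \<sigma>) \<union> ?V (1 # \<sigma>)"
    proof
      fix y assume "y \<in> ?V \<sigma>"
      then obtain p where p: "p \<in> P" "seg p (length \<sigma>) = \<sigma>" "eval r p xs = Some y" by blast
      then have "p (length \<sigma>) \<in> {0, 1}" using range by blast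
      then show "y \<in> ?V (0 # \<sigma>) \<union> ?V (1 # \<sigma>)"
        using p by (auto simp: seg_Suc)
    qed
    with \<sigma> have "infinite (?V (0 # \<sigma>)) \<or> infinite (?V (1 # \<sigma>))"
      by (meson finite_UnI finite_subset)
    then show "\<exists>a. infinite (?V (a # \<sigma>)) \<and> a \<in> {0, 1}" by blast
  qed
  then obtain g where g: "\<And>m. infinite (?V (seg g m))" "\<And>m. g m \<in> {0, 1}" by blast
  have seg_eqD: "p i = g i" if "seg p m = seg g m" "i < m" for p m i
    using that seg_nth by metis
  have "g \<in> P"
  proof (rule ccontr)
    assume "g \<notin> P"
    moreover have "openin cantor_space ({f. range f \<subseteq> {0, 1}} - P)"
      using P by (simp add: closedin_def topspace_sequence_space)
    ultimately obtain m where m: "\<And>q. range q \<subseteq> {0, 1} \<Longrightarrow> (\<And>i. i < m \<Longrightarrow> q i = g i) \<Longrightarrow> q \<notin> P"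
      using openin_sequence_space_agree[of "{0, 1}" _ g] g(2) by (metis (no_types, lifting)
        DiffE DiffI image_subsetI mem_Collect_eq)
    obtain p where p: "p \<in> P" "seg p m = seg g m"
      using infinite_imp_nonempty[OF g(1)[of m]] by auto
    show False
      using m[OF range[OF p(1)] seg_eqD[OF p(2)]] p(1) by contradiction
  qed
  then obtain y where y: "eval r g xs = Some y" using total by blast
  then obtain m where m: "\<And>g'. (\<And>i. i < m \<Longrightarrow> g' i = g i) \<Longrightarrow> eval r g' xs = Some y"
    using eval_finite_use by blast
  have "?V (seg g m) \<subseteq> {y}"
  proof
    fix z assume "z \<in> ?V (seg g m)"
    then obtain p where p: "seg p m = seg g m" "eval r p xs = Some z" by auto
    then show "z \<in> {y}"
      using m[OF seg_eqD[OF p(1)]] by simp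
  qed
  then show False using g(1)[of m] finite_subset by blast
qed

section \<open>The diagonal class\<close>

text \<open>Junk if there is no certificate for \<open>n\<close>; the junk value is then not excluded by the tree.\<close>

definition diag_value :: "nat \<Rightarrow> nat" where
  "diag_value n = colour (LEAST s. certificate s n)"

lemma paths_diag_tree_iff:
  "f \<in> paths diag_tree \<longleftrightarrow> (\<forall>n. (\<exists>s. certificate s n) \<longrightarrow> f n \<noteq> diag_value n)"
proof
  assume f: "f \<in> paths diag_tree"
  show "\<forall>n. (\<exists>s. certificate s n) \<longrightarrow> f n \<noteq> diag_value n"
  proof (intro allI impI)
    fix n assume ex: "\<exists>s. certificate s n"
    define s where "s = (LEAST s. certificate s n)"
    have s: "certificate s n" "\<And>s'. s' < s \<Longrightarrow> \<not> certificate s' n"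
      unfolding s_def using LeastI_ex[OF ex] not_less_Least by metis+
    \<comment> \<open>This segment is long enough to contain position \<open>n\<close> and to have
      reached stage \<open>s\<close>.\<close>
    have "map f [0..<Suc (max n s)] \<in> diag_tree"
      using f unfolding paths_def by blast
    then have "\<forall>i<Suc (max n s). \<forall>t<Suc (max n s).
        certificate t i \<and> (\<forall>s'<t. \<not> certificate s' i) \<longrightarrow> f i \<noteq> colour t"
      by (simp add: diag_tree_def del: upt_Suc)
    moreover have "n < Suc (max n s)" "s < Suc (max n s)" by auto
    ultimately have "f n \<noteq> colour s"
      using s by blast
    then show "f n \<noteq> diag_value n"
      by (simp add: diag_value_def s_def)
  qed
next
  assume f: "\<forall>n. (\<exists>s. certificate s n) \<longrightarrow> f n \<noteq> diag_value n"
  have "f n \<noteq> colour s" if "certificate s n" "\<forall>s'<s. \<not> certificate s' n" for n s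
  proof -
    have "(LEAST s. certificate s n) = s"
      using that by (intro Least_equality) (auto simp: not_less[symmetric])
    then show ?thesis
      using f that(1) by (auto simp: diag_value_def)
  qed
  then show "f \<in> paths diag_tree"
    by (simp add: paths_def diag_tree_def)
qed

lemma certificate_exists:
  assumes "derivable 0 (prod_encode (7, n)) (list_encode [n]) y"
  shows "\<exists>s. certificate s n"
proof -
  let ?x = "fact_code 0 (prod_encode (7, n)) (list_encode [n]) y"
  obtain L where "derivation L" "?x \<in> set L"
    using assms unfolding derivable_def by blast
  \<comment> \<open>Dropping the entries in front of the wanted fact makes it the head, as a
    certificate requires.\<close>
  then obtain L' where "derivation (?x # L')"
    using derivation_appendD by (metis split_list)
  then have "certificate (list_encode (?x # L')) n"
    by (simp add: certificate_def colour_def fact_code_def)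
  then show ?thesis by blast
qed

lemma no_finite_valued_self_map:
  assumes self: "\<And>g. g \<in> paths diag_tree \<Longrightarrow> \<exists>f\<in>paths diag_tree. \<forall>n. eval r g [n] = Some (f n)"
    and Y: "finite Y" "\<And>g. g \<in> paths diag_tree \<Longrightarrow> \<exists>y\<in>Y. eval r g [code r] = Some y"
  shows False
proof -
  let ?n = "code r"
  \<comment> \<open>Avoiding \<open>diag_value\<close> everywhere, even at its junk values, is more
    than membership demands, but it lets a total function play the role of the partial one.\<close>
  have avoid: "g \<in> paths diag_tree" if "\<And>i. g i \<noteq> diag_value i" for g
    using that by (simp add: paths_diag_tree_iff)
  have "\<exists>y. derivable 0 (prod_encode (7, ?n)) (list_encode [?n]) y"
    using Y avoid by (intro homogeneous_complete[where p = diag_value]) auto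
  then have ex: "\<exists>s. certificate s ?n"
    using certificate_exists by blast
  define s where "s = (LEAST s. certificate s ?n)"
  have s: "certificate s ?n"
    unfolding s_def using LeastI_ex[OF ex] .
  obtain x L where L: "list_decode s = x # L"
    using s unfolding certificate_def by (metis list.exhaust list_decode_inverse list_encode.simps(1))
  then have "s = list_encode (x # L)" by (metis list_decode_inverse)
  then have "x = fact_code 0 (prod_encode (7, ?n)) (list_encode [?n]) (diag_value ?n)"
    using s unfolding diag_value_def s_def[symmetric] by (simp add: certificate_def)
  \<comment> \<open>The root of the certified tree has the empty segment, so the starting oracle is
    arbitrary and the avoidance hypothesis is vacuous.\<close>
  then obtain g where "\<forall>i. g i \<noteq> diag_value i" "eval r g [?n] = Some (diag_value ?n)"
    using homogeneous_sound[of "x # L" "\<lambda>_. 0" 0 r "[?n]" "diag_value ?n" diag_value] s L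
    unfolding certificate_def by auto
  moreover from this obtain f where "f \<in> paths diag_tree" "eval r g [?n] = Some (f ?n)"
    using self avoid by blast
  ultimately show False
    using ex by (simp add: paths_diag_tree_iff)
qed

theorem theorem2:
  "\<exists>Q. closedin baire_space Q \<and> Pi01_class Q \<and>
       (\<forall>P. closedin cantor_space P \<longrightarrow> \<not> medvedev_equiv Q P)"
proof (intro exI conjI allI impI notI)
  show "closedin baire_space (paths diag_tree)"
    by (rule closedin_baire_space_paths)
  show "Pi01_class (paths diag_tree)"
    unfolding Pi01_class_def using computable_tree_diag_tree by blast
  fix P assume P: "closedin cantor_space P" and "medvedev_equiv (paths diag_tree) P"
  then obtain \<Psi> \<Phi> where "turing_functional \<Psi>" "turing_functional \<Phi>"
    and *: "\<forall>p\<in>P. \<exists>f\<in>paths diag_tree. \<Psi> p = Some \<circ> f" "\<forall>g\<in>paths diag_tree. \<exists>p\<in>P. \<Phi> g = Some \<circ> p"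
    unfolding medvedev_equiv_def medvedev_le_def by blast
  then obtain c d where "\<Psi> = (\<lambda>g n. eval c g [n])" "\<Phi> = (\<lambda>g n. eval d g [n])"
    unfolding turing_functional_def by blast
  with * have c: "\<And>p. p \<in> P \<Longrightarrow> \<exists>f\<in>paths diag_tree. \<forall>n. eval c p [n] = Some (f n)"
    and d: "\<And>g. g \<in> paths diag_tree \<Longrightarrow> \<exists>p\<in>P. \<forall>n. eval d g [n] = Some (p n)"
    by (auto simp: fun_eq_iff)
  define r where "r = subst_oracle d c"
  \<comment> \<open>Only convergent values transfer to the composite; this suffices because
    \<open>c\<close> is total on \<open>P\<close>.\<close>
  have r: "\<exists>p\<in>P. \<forall>n y. eval c p [n] = Some y \<longrightarrow> eval r g [n] = Some y" if "g \<in> paths diag_tree" for g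
    unfolding r_def using d[OF that] eval_subst_oracle by metis
  show False
  proof (rule no_finite_valued_self_map)
    show "\<exists>f\<in>paths diag_tree. \<forall>n. eval r g [n] = Some (f n)" if "g \<in> paths diag_tree" for g
      using r[OF that] c by metis
    \<comment> \<open>Each \<open>g\<close> is first mapped into \<open>P\<close>, so the values of
      the composite are among those of \<open>c\<close> on \<open>P\<close>.\<close>
    show "finite {y. \<exists>p\<in>P. eval c p [code r] = Some y}"
      using c by (intro finite_values_on_cantor_closed[OF P]) fastforce
    show "\<exists>y\<in>{y. \<exists>p\<in>P. eval c p [code r] = Some y}. eval r g [code r] = Some y"
      if "g \<in> paths diag_tree" for g
      using r[OF that] c by (metis (mono_tags, lifting) mem_Collect_eq)
  qed
qed

end
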